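(* Let $\mathcal F$ be a finite family of lines in general position in $\mathbb{R}^2$ and let $n\ge 0$ be an integer. Assume that a subfamily $\mathcal G\subset\mathcal F$ spans a cell $D$, and that at least $n$ lines from $\mathcal F\setminus\mathcal G$ intersect $D$. Then there is a subset $\mathcal H\subset\mathcal F$ defining a cell $C$ such that exactly $n$ lines from $\mathcal F\setminus\mathcal H$ intersect $C$.
   Context: A finite family of lines in $\mathbb{R}^2$ is in general position if no three lines are concurrent, no two are parallel, and no line is vertical. Let $n\ge k\ge 2$. A family of $n$ lines in general position defines a $k$-cell $P$ if $P$ is a connected component of the complement of the union of these lines (so $P$ is an open convex set, bounded or unbounded) and the boundary of $P$ contains a segment (of positive length, possibly a half-line) from exactly $k$ of the lines. A family defines a cell $C$ if it defines $C$ as a $k$-cell for some $k\ge 2$. A family of lines spans a $k$-cell $D$ if it contains $k$ lines that define $D$ as a $k$-cell (i.e. all $k$ of these lines contribute a segment to the boundary of $D$); it spans a cell if it spans a $k$-cell for some $k\ge 2$. *)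

theory Defs
  imports "HOL-Analysis.Analysis"
begin

definition is_line :: "(real^2) set \<Rightarrow> bool" where
  "is_line L \<longleftrightarrow> affine L \<and> aff_dim L = 1"

definition vertical :: "(real^2) set \<Rightarrow> bool" where
  "vertical L \<longleftrightarrow> (\<exists>c. L = {x. x $ 1 = c})"

text \<open>Families are sets of lines: a repeated line would be parallel to its copy.\<close>

definition general_position :: "(real^2) set set \<Rightarrow> bool" where
  "general_position F \<longleftrightarrow>
     finite F \<and> (\<forall>L\<in>F. is_line L \<and> \<not> vertical L) \<and>
     (\<forall>L\<in>F. \<forall>M\<in>F. L \<noteq> M \<longrightarrow> \<not> affine_parallel L M) \<and>
     (\<forall>L\<in>F. \<forall>M\<in>F. \<forall>N\<in>F. L \<noteq> M \<and> M \<noteq> N \<and> L \<noteq> N \<longrightarrow> L \<inter> M \<inter> N = {})"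

text \<open>A half-line contains bounded segments of positive length, so testing bounded
  segments also covers unbounded edges.\<close>

definition contributing_lines :: "(real^2) set set \<Rightarrow> (real^2) set \<Rightarrow> (real^2) set set" where
  "contributing_lines H P =
     {L\<in>H. \<exists>a b. a \<noteq> b \<and> closed_segment a b \<subseteq> L \<and> closed_segment a b \<subseteq> frontier P}"

text \<open>Lines of \<open>H\<close> that do not touch the boundary of the cell are allowed here.\<close>

definition defines_k_cell :: "(real^2) set set \<Rightarrow> nat \<Rightarrow> (real^2) set \<Rightarrow> bool" where
  "defines_k_cell H k P \<longleftrightarrow>
     general_position H \<and> 2 \<le> k \<and> k \<le> card H \<and>
     P \<in> components (- \<Union>H) \<and> card (contributing_lines H P) = k"

definition defines_cell :: "(real^2) set set \<Rightarrow> (real^2) set \<Rightarrow> bool" where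
  "defines_cell H C \<longleftrightarrow> (\<exists>k\<ge>2. defines_k_cell H k C)"

text \<open>The remaining lines of \<open>G\<close> may cut through \<open>D\<close>.\<close>

definition spans_k_cell :: "(real^2) set set \<Rightarrow> nat \<Rightarrow> (real^2) set \<Rightarrow> bool" where
  "spans_k_cell G k D \<longleftrightarrow> (\<exists>K\<subseteq>G. card K = k \<and> defines_k_cell K k D)"

definition spans_cell :: "(real^2) set set \<Rightarrow> (real^2) set \<Rightarrow> bool" where
  "spans_cell G D \<longleftrightarrow> (\<exists>k\<ge>2. spans_k_cell G k D)"

end

theory Submission imports Defs begin

text \<open>
  The number of crossing lines can be lowered one at a time. Let \<open>H\<close> be a subfamily with a cell \<open>C\<close>
  that is crossed by \<open>m > 0\<close> of the remaining lines. Each crossing line \<open>L\<close> splits \<open>C\<close> into two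
  pieces, both of which are cells of \<open>H \<union> {L}\<close>. Among all pieces, over all choices of \<open>L\<close>, take one
  that is crossed by the largest number of lines. If some other crossing line \<open>L'\<close> missed this piece,
  then \<open>L\<close> and \<open>L'\<close> would not meet inside \<open>C\<close>, and the piece of \<open>C\<close> cut off by \<open>L'\<close> that contains the
  chosen piece would be crossed by the same lines and by \<open>L\<close> in addition. Hence the chosen piece is
  crossed by all \<open>m - 1\<close> crossing lines other than \<open>L\<close> (lemma \<open>cell_with_one_crossing_less\<close>).
  Starting from the cell \<open>D\<close>, every number up to the initial one is reached.

  The pieces must be \<open>k\<close>-cells with \<open>k \<ge> 2\<close>. This is automatic for every component of the
  complement of two or more lines in general position (lemma \<open>two_contributing_lines\<close>): a line
  that contributes no segment touches the boundary in at most one point. If no line other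
  than \<open>L\<close> contributed, then only finitely many boundary points would lie in the open half-plane \<open>S\<close>
  of \<open>L\<close> that contains the component. As \<open>S\<close> minus a finite set is connected, the component would be
  \<open>S\<close> minus finitely many points, but a second line removes infinitely many points from \<open>S\<close>.
\<close>

section \<open>Lines in the plane\<close>

lemma line_as_hyperplane:
  assumes "is_line L"
  obtains a b where "a \<noteq> 0" "L = {x. a \<bullet> x = b}"
proof -
  have "aff_dim L = int (DIM(real^2) - 1)"
    using assms by (simp add: is_line_def)
  then have "\<exists>a b. a \<noteq> 0 \<and> affine hull L = {x. a \<bullet> x = b}"
    by (rule aff_dim_eq_hyperplane[THEN iffD1])
  then obtain a b where "a \<noteq> 0" "affine hull L = {x. a \<bullet> x = b}"
    by blast
  moreover have "affine hull L = L"
    using assms by (simp add: is_line_def)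
  ultimately show thesis using that by simp
qed

lemma line_subset_eq:
  assumes "is_line L" "is_line M" "L \<subseteq> M"
  shows "L = M"
  using assms unfolding is_line_def
  by (metis affine_dim_equal aff_dim_empty)

lemma general_position_subset:
  assumes "general_position F" "H \<subseteq> F"
  shows "general_position H"
  using assms finite_subset unfolding general_position_def by (meson subsetD)

lemma parallel_hyperplanes:
  fixes a :: "'a::real_inner"
  assumes "a \<noteq> 0"
  shows "affine_parallel {x. a \<bullet> x = b} {x. a \<bullet> x = c}"
proof -
  define u where "u = ((c - b) / (a \<bullet> a)) *\<^sub>R a"
  have u: "a \<bullet> u = c - b" using assms by (simp add: u_def)
  have "{x. a \<bullet> x = c} = (\<lambda>x. u + x) ` {x. a \<bullet> x = b}"
  proof safe
    fix x assume "c = a \<bullet> x"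
    then have "a \<bullet> (x - u) = b" using u by (simp add: inner_diff_right)
    then show "x \<in> (\<lambda>x. u + x) ` {x. a \<bullet> x = b}"
      by (intro image_eqI[of _ _ "x - u"]) auto
  qed (use u in \<open>simp add: inner_add_right\<close>)
  then show ?thesis unfolding affine_parallel_def by blast
qed

lemma infinite_line_Int_halfspace:
  assumes "is_line M" "a \<noteq> 0" "is_line {x. a \<bullet> x = b}"
    and "\<not> affine_parallel {x. a \<bullet> x = b} M"
  shows "infinite (M \<inter> {x. a \<bullet> x < b})"
proof -
  obtain p where p: "p \<in> M" using assms(1) unfolding is_line_def
    by (metis aff_dim_empty ex_in_conv one_neq_neg_one)
  have "\<not> M \<subseteq> {x. a \<bullet> x = a \<bullet> p}"
  proof
    assume sub: "M \<subseteq> {x. a \<bullet> x = a \<bullet> p}"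
    have "is_line {x. a \<bullet> x = a \<bullet> p}"
      using assms(2) by (simp add: is_line_def affine_hyperplane)
    then have "M = {x. a \<bullet> x = a \<bullet> p}" using line_subset_eq assms(1) sub by blast
    then show False using assms(4) parallel_hyperplanes[OF assms(2)] by metis
  qed
  then obtain q where q: "q \<in> M" "a \<bullet> q \<noteq> a \<bullet> p" by auto
  define s where "s = a \<bullet> (q - p)"
  have s: "s \<noteq> 0" using q by (simp add: s_def inner_diff_right)
  define g where "g = (\<lambda>r. p + ((r - a \<bullet> p) / s) *\<^sub>R (q - p))"
  \<comment> \<open>\<open>g\<close> parametrises the line by the value of the functional that defines the half-plane.\<close>
  have g: "a \<bullet> g r = r" for r
    using s by (simp add: g_def inner_add_right flip: s_def)
  have "g r \<in> M" for r
  proof -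
    have "g r = (1 - (r - a \<bullet> p) / s) *\<^sub>R p + ((r - a \<bullet> p) / s) *\<^sub>R q"
      by (simp add: g_def algebra_simps)
    then show ?thesis using p q(1) assms(1) unfolding is_line_def affine_alt by metis
  qed
  then have "g ` {..<b} \<subseteq> M \<inter> {x. a \<bullet> x < b}" using g by auto
  moreover have "infinite (g ` {..<b})"
    using g by (metis finite_imageD infinite_Iio inj_on_inverseI)
  ultimately show ?thesis using finite_subset by blast
qed

section \<open>Cells\<close>

lemma connected_on_one_side:
  fixes a :: "'a::real_inner"
  assumes "connected P" "P \<inter> {x. a \<bullet> x = b} = {}"
  shows "P \<subseteq> {x. a \<bullet> x < b} \<or> P \<subseteq> {x. a \<bullet> x > b}"
proof (rule ccontr)
  assume "\<not> ?thesis"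
  then obtain x y where "x \<in> P" "y \<in> P" "a \<bullet> x \<ge> b" "a \<bullet> y \<le> b" by force
  then obtain z where "z \<in> P" "a \<bullet> z = b"
    using connected_ivt_hyperplane[OF assms(1)] by blast
  then show False using assms(2) by blast
qed

text \<open>A normal vector may be replaced by its negative, so that it points away from the cell.\<close>

lemma cell_in_halfspace:
  assumes "is_line L" "connected P" "P \<inter> L = {}"
  obtains a b where "a \<noteq> 0" "L = {x. a \<bullet> x = b}" "P \<subseteq> {x. a \<bullet> x < b}"
proof -
  obtain a b where ab: "a \<noteq> 0" "L = {x. a \<bullet> x = b}"
    using line_as_hyperplane[OF assms(1)] .
  from connected_on_one_side[of P a b] assms(2,3) ab(2)
  consider "P \<subseteq> {x. a \<bullet> x < b}" | "P \<subseteq> {x. (-a) \<bullet> x < -b}" by auto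
  then show thesis
  proof cases
    case 1
    then show thesis using that ab by blast
  next
    case 2
    then show thesis using that[of "-a" "-b"] ab by simp
  qed
qed

lemma line_closed: "is_line L \<Longrightarrow> closed L"
  using line_as_hyperplane closed_hyperplane by metis

lemma cell_open:
  assumes "general_position H" "P \<in> components (- \<Union>H)"
  shows "open P"
proof -
  have "closed (\<Union>H)"
    using assms(1) line_closed unfolding general_position_def by (intro closed_Union) auto
  then show ?thesis using assms(2) open_components by blast
qed

lemma cell_disjoint_line:
  assumes "P \<in> components (- \<Union>H)" "L \<in> H"
  shows "P \<inter> L = {}"
  using in_components_subset[OF assms(1)] assms(2) by blast

text \<open>The two ends of a segment in a cell lie on the same side of every line, so the segment
  meets no line and stays in the cell.\<close>

lemma cell_convex:
  assumes "general_position H" "P \<in> components (- \<Union>H)"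
  shows "convex P"
proof (rule convex_contains_segment[THEN iffD2], intro ballI)
  fix x y assume xy: "x \<in> P" "y \<in> P"
  have "closed_segment x y \<inter> L = {}" if "L \<in> H" for L
  proof -
    have "is_line L" using assms(1) that by (simp add: general_position_def)
    moreover have "P \<inter> L = {}" using assms(2) that by (rule cell_disjoint_line)
    ultimately obtain a b where ab: "L = {x. a \<bullet> x = b}" "P \<subseteq> {x. a \<bullet> x < b}"
      using cell_in_halfspace in_components_connected[OF assms(2)] by metis
    then have "closed_segment x y \<subseteq> {x. a \<bullet> x < b}"
      using xy by (intro closed_segment_subset convex_halfspace_lt) auto
    then show ?thesis using ab(1) by auto
  qed
  then have "closed_segment x y \<subseteq> - \<Union>H" by auto
  then show "closed_segment x y \<subseteq> P"
    by (intro components_maximal[OF assms(2)]) (use xy in auto)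
qed

lemma cell_Int_halfspace:
  assumes "general_position H" "C \<in> components (- \<Union>H)" "C \<inter> {x. a \<bullet> x < b} \<noteq> {}"
  shows "C \<inter> {x. a \<bullet> x < b} \<in> components (- \<Union>(insert {x. a \<bullet> x = b} H))"
  unfolding in_components_maximal
proof (intro conjI allI impI)
  show "C \<inter> {x. a \<bullet> x < b} \<subseteq> - \<Union>(insert {x. a \<bullet> x = b} H)"
    using in_components_subset[OF assms(2)] by auto
  show "connected (C \<inter> {x. a \<bullet> x < b})"
    by (intro convex_connected convex_Int cell_convex[OF assms(1,2)] convex_halfspace_lt)
  fix T
  assume T: "T \<noteq> {} \<and> C \<inter> {x. a \<bullet> x < b} \<subseteq> T \<and> T \<subseteq> - \<Union>(insert {x. a \<bullet> x = b} H) \<and> connected T"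
  have "T \<subseteq> C" using T assms(3) by (intro components_maximal[OF assms(2)]) auto
  moreover have "T \<subseteq> {x. a \<bullet> x < b} \<or> T \<subseteq> {x. a \<bullet> x > b}"
    using T by (intro connected_on_one_side) auto
  moreover have "\<not> T \<subseteq> {x. a \<bullet> x > b}"
  proof -
    obtain x where "x \<in> T" "a \<bullet> x < b" using T assms(3) by blast
    then show ?thesis by auto
  qed
  ultimately show "T = C \<inter> {x. a \<bullet> x < b}" using T by blast
qed (use assms in auto)

section \<open>Every cell has at least two sides\<close>

text \<open>The closure of the cell is convex and meets the line only in the frontier of the cell,
  so two common points would yield a common segment.\<close>

lemma noncontributing_line_meets_frontier_finite:
  assumes "general_position H" "P \<in> components (- \<Union>H)"
    and "L \<in> H" "L \<notin> contributing_lines H P"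
  shows "finite (frontier P \<inter> L)"
proof -
  have "x = y" if xy: "x \<in> frontier P \<inter> L" "y \<in> frontier P \<inter> L" for x y
  proof (rule ccontr)
    assume "x \<noteq> y"
    have "affine L" using assms(1,3) by (simp add: general_position_def is_line_def)
    then have "closed_segment x y \<subseteq> L"
      using xy by (intro closed_segment_subset affine_imp_convex) auto
    moreover have "closed_segment x y \<subseteq> closure P"
      using xy cell_convex[OF assms(1,2)]
      by (intro closed_segment_subset convex_closure) (auto simp: frontier_def)
    moreover have "P \<inter> L = {}" using assms(2,3) by (rule cell_disjoint_line)
    ultimately have "closed_segment x y \<subseteq> frontier P"
      using interior_subset[of P] unfolding frontier_def by blast
    then show False
      using assms(3,4) \<open>x \<noteq> y\<close> \<open>closed_segment x y \<subseteq> L\<close> unfolding contributing_lines_def by blast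
  qed
  then show ?thesis by (metis finite.simps is_singletonI' is_singleton_def)
qed

lemma two_contributing_lines:
  assumes gp: "general_position H" and P: "P \<in> components (- \<Union>H)" and "2 \<le> card H"
  shows "2 \<le> card (contributing_lines H P)"
proof (rule ccontr)
  assume few: "\<not> ?thesis"
  have fin: "finite H" using gp by (simp add: general_position_def)
  have sub: "contributing_lines H P \<subseteq> H" by (auto simp: contributing_lines_def)
  have "H \<noteq> {}" using \<open>2 \<le> card H\<close> by auto
  have "\<exists>L\<in>H. contributing_lines H P \<subseteq> {L}"
  proof (cases "contributing_lines H P = {}")
    case True
    then show ?thesis using \<open>H \<noteq> {}\<close> by blast
  next
    case False
    then have "card (contributing_lines H P) = 1"
      using few finite_subset[OF sub fin]
      by (metis One_nat_def Suc_1 Suc_leI card_gt_0_iff le_neq_implies_less)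
    then show ?thesis using sub by (auto simp: card_1_singleton_iff)
  qed
  then obtain L where L: "L \<in> H" "contributing_lines H P \<subseteq> {L}" by blast
  have "\<not> H \<subseteq> {L}" using \<open>2 \<le> card H\<close> card_mono[of "{L}" H] by auto
  then obtain M where M: "M \<in> H" "M \<noteq> L" by blast
  have lines: "is_line L" "is_line M" "\<not> affine_parallel L M"
    using gp L(1) M unfolding general_position_def by auto
  obtain a b where ab: "a \<noteq> 0" "L = {x. a \<bullet> x = b}" "P \<subseteq> {x. a \<bullet> x < b}"
    using cell_in_halfspace[OF lines(1) in_components_connected[OF P] cell_disjoint_line[OF P L(1)]] .
  define S where "S = {x. a \<bullet> x < b}"
  define E where "E = (\<Union>N\<in>H - {L}. frontier P \<inter> N)"
  have "finite E"
    unfolding E_def using fin L(2) noncontributing_line_meets_frontier_finite[OF gp P] by blast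
  have "closed (\<Union>H)"
    using gp line_closed unfolding general_position_def by (intro closed_Union) auto
  then have "frontier P \<subseteq> \<Union>H"
    using frontier_of_components_closed_complement P by blast
  then have frontier: "frontier P \<subseteq> L \<union> E"
    unfolding E_def by blast
  have disj: "P \<inter> E = {}"
    using cell_disjoint_line[OF P] unfolding E_def by blast
  have "connected (S - E)"
    by (intro connected_open_diff_countable)
      (auto simp: S_def open_halfspace_lt convex_connected convex_halfspace_lt
        \<open>finite E\<close> countable_finite)
  moreover have "(S - E) \<inter> frontier P = {}" using frontier ab(2) by (auto simp: S_def)
  moreover have "(S - E) \<inter> P \<noteq> {}"
    using disj ab(3) in_components_nonempty[OF P] by (auto simp: S_def)
  ultimately have "S - E \<subseteq> P" using connected_Int_frontier by blast
  then have "M \<inter> S \<subseteq> E" using cell_disjoint_line[OF P M(1)] by blast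
  then have "finite (M \<inter> S)" using \<open>finite E\<close> finite_subset by blast
  then show False
    using infinite_line_Int_halfspace[OF lines(2) ab(1)] lines ab(2) by (simp add: S_def)
qed

lemma defines_cell_iff:
  "defines_cell H C \<longleftrightarrow> general_position H \<and> 2 \<le> card H \<and> C \<in> components (- \<Union>H)"
proof
  assume *: "general_position H \<and> 2 \<le> card H \<and> C \<in> components (- \<Union>H)"
  then have "card (contributing_lines H C) \<le> card H"
    by (intro card_mono) (auto simp: general_position_def contributing_lines_def)
  then show "defines_cell H C"
    using * two_contributing_lines unfolding defines_cell_def defines_k_cell_def by blast
qed (auto simp: defines_cell_def defines_k_cell_def)

section \<open>Lowering the number of crossing lines\<close>

lemma open_contains_step:
  fixes z v :: "'a::real_normed_vector"
  assumes "open C" "z \<in> C"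
  obtains e :: real where "e > 0" "z + e *\<^sub>R v \<in> C"
proof -
  have "((\<lambda>e::real. z + e *\<^sub>R v) \<longlongrightarrow> z + 0 *\<^sub>R v) (at_right 0)"
    by (intro tendsto_intros)
  then have "\<forall>\<^sub>F e in at_right 0. z + e *\<^sub>R v \<in> C"
    using assms by (auto dest: topological_tendstoD)
  moreover have "\<forall>\<^sub>F e::real in at_right 0. e > 0"
    by (rule eventually_at_right_less)
  ultimately have "\<forall>\<^sub>F e::real in at_right 0. e > 0 \<and> z + e *\<^sub>R v \<in> C"
    by eventually_elim simp
  then show thesis using that eventually_happens by force
qed

text \<open>Let \<open>L\<close> cut \<open>C\<close> and let another line \<open>L'\<close> miss one of the two pieces. Then the points of \<open>L\<close> in
  \<open>C\<close> are on the same side of \<open>L'\<close> as this piece: a segment to the piece from a point on the other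
  side would cross \<open>L'\<close> inside the piece, and a point on \<open>L'\<close> itself could be moved along \<open>L'\<close> into
  the piece.\<close>

lemma missed_piece_same_side:
  assumes "open C" "convex C"
    and L: "is_line {x. a \<bullet> x = b}" and L': "is_line {x. c \<bullet> x = d}"
    and ne: "{x. c \<bullet> x = d} \<noteq> {x. a \<bullet> x = b}"
    and y: "y \<in> C" "a \<bullet> y < b" "c \<bullet> y < d"
    and miss: "C \<inter> {x. a \<bullet> x < b} \<inter> {x. c \<bullet> x = d} = {}"
    and z: "z \<in> C" "a \<bullet> z = b"
  shows "c \<bullet> z < d"
proof (rule ccontr)
  assume "\<not> c \<bullet> z < d"
  then consider "c \<bullet> z = d" | "c \<bullet> z > d" by linarith
  then show False
  proof cases
    case 1
    obtain w where w: "c \<bullet> w = d" "a \<bullet> w \<noteq> b"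
      using line_subset_eq[OF L' L] ne by blast
    define v where "v = (if a \<bullet> w < b then w - z else z - w)"
    have v: "c \<bullet> v = 0" "a \<bullet> v < 0"
      using w 1 z(2) by (auto simp: v_def inner_diff_right)
    obtain e where e: "e > 0" "z + e *\<^sub>R v \<in> C"
      using open_contains_step[OF assms(1) z(1)] .
    have "c \<bullet> (z + e *\<^sub>R v) = d" using v 1 by (simp add: inner_add_right)
    moreover have "a \<bullet> (z + e *\<^sub>R v) < b"
      using v e z by (simp add: inner_add_right mult_pos_neg)
    ultimately show False using e(2) miss by blast
  next
    case 2
    define t where "t = (c \<bullet> z - d) / (c \<bullet> z - c \<bullet> y)"
    have t: "0 < t" "t \<le> 1" using 2 y(3) by (auto simp: t_def field_simps)
    define u where "u = (1 - t) *\<^sub>R z + t *\<^sub>R y"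
    have "u \<in> C" unfolding u_def using t z(1) y(1) by (intro convexD_alt[OF assms(2)]) auto
    moreover have "c \<bullet> u = d"
    proof -
      have "t * (c \<bullet> z - c \<bullet> y) = c \<bullet> z - d" using 2 y(3) by (simp add: t_def)
      then show ?thesis by (simp add: u_def algebra_simps)
    qed
    moreover have "a \<bullet> u < b"
    proof -
      have "a \<bullet> u = b - t * (b - a \<bullet> y)"
        using z(2) by (simp add: u_def algebra_simps)
      then show ?thesis using t y(2) by simp
    qed
    ultimately show False using miss by blast
  qed
qed

text \<open>Maximising the number of lines that cross the piece bounds the loss: the piece loses only the
  line that cuts it off.\<close>

lemma cell_with_one_crossing_less:
  assumes gp: "general_position F" and "H \<subseteq> F" and "defines_cell H C"
    and m: "card {L \<in> F - H. L \<inter> C \<noteq> {}} = Suc m"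
  obtains H' C' where "H' \<subseteq> F" "defines_cell H' C'" "card {L \<in> F - H'. L \<inter> C' \<noteq> {}} = m"
proof -
  define X where "X = {L \<in> F - H. L \<inter> C \<noteq> {}}"
  have gpH: "general_position H" and C: "C \<in> components (- \<Union>H)" and "2 \<le> card H"
    using assms(3) by (auto simp: defines_cell_iff)
  have finF: "finite F" and lineF: "\<And>L. L \<in> F \<Longrightarrow> is_line L"
    using gp by (auto simp: general_position_def)
  note opC = cell_open[OF gpH C] and convC = cell_convex[OF gpH C]
  define side where "side = (\<lambda>(a, b). {x::real^2. a \<bullet> x < b})"
  \<comment> \<open>A pair of a normal vector and an offset encodes a line together with one of its sides.\<close>
  define good where "good = (\<lambda>(a, b). a \<noteq> 0 \<and> {x. a \<bullet> x = b} \<in> X)"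
  define crossed where "crossed = (\<lambda>h. {N \<in> F. N \<inter> (C \<inter> side h) \<noteq> {}})"
  have "X \<noteq> {}" using m unfolding X_def by (metis card.empty nat.distinct(1))
  then obtain L0 where "L0 \<in> X" by blast
  moreover obtain a0 b0 where "a0 \<noteq> 0" "L0 = {x. a0 \<bullet> x = b0}"
    using line_as_hyperplane[of L0] lineF \<open>L0 \<in> X\<close> by (auto simp: X_def)
  ultimately have "good (a0, b0)" by (simp add: good_def)
  moreover have "\<forall>h. good h \<longrightarrow> card (crossed h) < Suc (card F)"
    using finF by (auto simp: crossed_def less_Suc_eq_le intro!: card_mono)
  ultimately obtain h where h: "good h" "\<And>h'. good h' \<Longrightarrow> card (crossed h') \<le> card (crossed h)"
    using ex_has_greatest_nat[of good "(a0, b0)" "\<lambda>h. card (crossed h)"] by blast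
  obtain a b where hab: "h = (a, b)" by fastforce
  define L where "L = {x. a \<bullet> x = b}"
  have a: "a \<noteq> 0" and LX: "L \<in> X" using h(1) by (auto simp: good_def hab L_def)
  define C' where "C' = C \<inter> {x. a \<bullet> x < b}"
  obtain z where z: "z \<in> C" "a \<bullet> z = b" using LX by (auto simp: X_def L_def)
  obtain e where e: "e > 0" "z + e *\<^sub>R (- a) \<in> C"
    using open_contains_step[OF opC z(1)] .
  have "a \<bullet> (z + e *\<^sub>R (- a)) < b"
    using a z(2) e(1) by (simp add: inner_diff_right)
  then have ne: "C' \<noteq> {}" using e(2) by (auto simp: C'_def)
  have comp: "C' \<in> components (- \<Union>(insert L H))"
    using cell_Int_halfspace[OF gpH C] ne by (simp add: C'_def L_def)
  have L: "L \<in> F" "L \<notin> H" "is_line L" using LX lineF by (auto simp: X_def)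
  have H': "insert L H \<subseteq> F" using L assms(2) by auto
  have all: "L' \<inter> C' \<noteq> {}" if L': "L' \<in> X - {L}" for L'
  proof
    assume miss: "L' \<inter> C' = {}"
    have line': "is_line L'" using L' lineF by (auto simp: X_def)
    obtain c d where cd: "c \<noteq> 0" "L' = {x. c \<bullet> x = d}" "C' \<subseteq> {x. c \<bullet> x < d}"
      using cell_in_halfspace[OF line' in_components_connected[OF comp]] miss by blast
    obtain y where y: "y \<in> C'" using ne by blast
    have "c \<bullet> z < d"
    proof (rule missed_piece_same_side[OF opC convC])
      show "is_line {x. a \<bullet> x = b}" using L(3) by (simp add: L_def)
      show "is_line {x. c \<bullet> x = d}" "{x. c \<bullet> x = d} \<noteq> {x. a \<bullet> x = b}"
        using line' L' cd(2) by (auto simp: L_def)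
      show "y \<in> C" "a \<bullet> y < b" "c \<bullet> y < d" using y cd(3) by (auto simp: C'_def)
      show "C \<inter> {x. a \<bullet> x < b} \<inter> {x. c \<bullet> x = d} = {}"
        using miss cd(2) by (auto simp: C'_def)
    qed (use z in auto)
    then have "L \<in> crossed (c, d)" using z L(1) by (auto simp: crossed_def side_def L_def)
    moreover have "L \<notin> crossed h" by (auto simp: crossed_def side_def hab L_def)
    moreover have "crossed h \<subseteq> crossed (c, d)"
      using cd(3) by (auto simp: crossed_def side_def hab C'_def)
    ultimately have "card (crossed h) < card (crossed (c, d))"
      using finF by (intro psubset_card_mono) (auto simp: crossed_def)
    moreover have "good (c, d)" using cd L' by (auto simp: good_def)
    ultimately show False using h(2) by (meson not_le)
  qed
  have "{N \<in> F - insert L H. N \<inter> C' \<noteq> {}} = X - {L}"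
    using all by (auto simp: X_def C'_def)
  moreover have "card (X - {L}) = m" using m LX unfolding X_def[symmetric] by simp
  moreover have "defines_cell (insert L H) C'"
    unfolding defines_cell_iff
    using comp general_position_subset[OF gp H'] \<open>2 \<le> card H\<close> L(2) finite_subset[OF assms(2) finF]
    by simp
  ultimately show thesis using that[OF H', of C'] by simp
qed

theorem theorem7p1:
  fixes F G :: "(real^2) set set" and D :: "(real^2) set" and n :: nat
  assumes "general_position F"
    and "G \<subseteq> F"
    and "spans_cell G D"
    and "n \<le> card {L \<in> F - G. L \<inter> D \<noteq> {}}"
  shows "\<exists>H C. H \<subseteq> F \<and> defines_cell H C \<and> card {L \<in> F - H. L \<inter> C \<noteq> {}} = n"
proof -
  define reached where
    "reached = (\<lambda>m. \<exists>H C. H \<subseteq> F \<and> defines_cell H C \<and> card {L \<in> F - H. L \<inter> C \<noteq> {}} = m)"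
  obtain K where K: "K \<subseteq> G" "defines_cell K D"
    using assms(3) unfolding spans_cell_def spans_k_cell_def defines_cell_def by blast
  define m where "m = card {L \<in> F - K. L \<inter> D \<noteq> {}}"
  have "finite F" using assms(1) by (simp add: general_position_def)
  then have "card {L \<in> F - G. L \<inter> D \<noteq> {}} \<le> m"
    unfolding m_def using K(1) by (intro card_mono) auto
  then have "n \<le> m" using assms(4) by linarith
  then have "reached n"
  proof (induction rule: inc_induct)
    case base
    show ?case unfolding reached_def using K assms(2) m_def by blast
  next
    case (step k)
    then obtain H C where HC: "H \<subseteq> F" "defines_cell H C"
        "card {L \<in> F - H. L \<inter> C \<noteq> {}} = Suc k"
      unfolding reached_def by blast
    show ?case
      by (rule cell_with_one_crossing_less[OF assms(1) HC]) (auto simp: reached_def)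
  qed
  then show ?thesis by (simp add: reached_def)
qed

end
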